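(* Let $\mathcal{D}_{\mathbb{C}}$ be the $\mathbb{C}$-linear extension to complex processes of $\mathcal{D}=\frac{D+D_*}{2}+i\frac{D-D_*}{2}$. Then $$\mathcal{D}_{\mathbb{C}}^2=\left[\frac{DD_*+D_*D}{2}\right]+i\left[\frac{D^2-D_*^2}{2}\right],$$ where $\mathcal{D}_{\mathbb{C}}^2=\mathcal{D}_{\mathbb{C}}\circ\mathcal{D}_{\mathbb{C}}$.
   Context: $(\mathcal{P}_t)$ and $(\mathcal{F}_t)$ are an increasing and a decreasing family of sub-$\sigma$-algebras of a probability space, processes are adapted to both. $DX(t)=\lim_{h\to0^+}E[\frac{X(t+h)-X(t)}{h}\mid\mathcal{P}_t]$, $D_*X(t)=\lim_{h\to0^+}E[\frac{X(t)-X(t-h)}{h}\mid\mathcal{F}_t]$ (limits in $L^1(\Omega)$) are Nelson's forward and backward derivatives of a real process. The $\mathbb{C}$-linear extension is $\mathcal{D}_{\mathbb{C}}(X+iY)=\mathcal{D}X+i\mathcal{D}Y$ for real processes $X,Y$. The identity is understood on processes for which all the iterated derivatives involved exist. *)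

theory Defs
  imports "HOL-Probability.Probability"
begin

text \<open>
  A real (complex) process is a function \<open>real \<Rightarrow> 'a \<Rightarrow> real\<close> (\<open>real \<Rightarrow> 'a \<Rightarrow> complex\<close>),
  of which only the values at times in the open interval \<open>I\<close> matter.
  Nelson derivatives are \<open>L\<^sup>1\<close> limits, hence determined only up to null sets; accordingly
  adaptedness is imposed up to a version, and equality of processes means
  almost sure equality at each time of \<open>I\<close>.
\<close>

definition as_measurable :: "'a measure \<Rightarrow> 'a measure \<Rightarrow> ('a \<Rightarrow> real) \<Rightarrow> bool" where
  "as_measurable M G f \<longleftrightarrow> (\<exists>g \<in> borel_measurable G. AE \<omega> in M. f \<omega> = g \<omega>)"

definition bi_adapted ::
  "'a measure \<Rightarrow> (real \<Rightarrow> 'a measure) \<Rightarrow> (real \<Rightarrow> 'a measure) \<Rightarrow> real set \<Rightarrow> (real \<Rightarrow> 'a \<Rightarrow> real) \<Rightarrow> bool"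
where
  "bi_adapted M P F I X \<longleftrightarrow>
     (\<forall>t\<in>I. X t \<in> borel_measurable M \<and> as_measurable M (P t) (X t) \<and> as_measurable M (F t) (X t))"

text \<open>
  \<open>L\<^sup>1\<close> limit, as \<open>h\<close> tends to \<open>0\<close> from the right, of the conditional expectations of \<open>Q h\<close>
  given \<open>G\<close>. Integrability of \<open>Q h\<close> for small \<open>h\<close> is required explicitly because
  \<open>real_cond_exp\<close> and the Bochner integral are total functions.
\<close>

definition cond_L1_limit :: "'a measure \<Rightarrow> 'a measure \<Rightarrow> (real \<Rightarrow> 'a \<Rightarrow> real) \<Rightarrow> ('a \<Rightarrow> real) \<Rightarrow> bool"
where
  "cond_L1_limit M G Q Y \<longleftrightarrow>
     integrable M Y \<and>
     (\<forall>\<^sub>F h in at_right 0. integrable M (Q h)) \<and>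
     ((\<lambda>h. \<integral>\<omega>. \<bar>real_cond_exp M G (Q h) \<omega> - Y \<omega>\<bar> \<partial>M) \<longlongrightarrow> 0) (at_right 0)"

definition is_fwd_deriv ::
  "'a measure \<Rightarrow> (real \<Rightarrow> 'a measure) \<Rightarrow> (real \<Rightarrow> 'a \<Rightarrow> real) \<Rightarrow> real \<Rightarrow> ('a \<Rightarrow> real) \<Rightarrow> bool"
where
  "is_fwd_deriv M P X t Y \<longleftrightarrow> cond_L1_limit M (P t) (\<lambda>h \<omega>. (X (t + h) \<omega> - X t \<omega>) / h) Y"

definition is_bwd_deriv ::
  "'a measure \<Rightarrow> (real \<Rightarrow> 'a measure) \<Rightarrow> (real \<Rightarrow> 'a \<Rightarrow> real) \<Rightarrow> real \<Rightarrow> ('a \<Rightarrow> real) \<Rightarrow> bool"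
where
  "is_bwd_deriv M F X t Y \<longleftrightarrow> cond_L1_limit M (F t) (\<lambda>h \<omega>. (X t \<omega> - X (t - h) \<omega>) / h) Y"

text \<open>
  \<open>D\<close> and \<open>D\<^sub>*\<close> as operators on real processes. They select a version of the limit, and are
  meaningful on the domain \<open>nelson_dom\<close> below.
\<close>

definition D_fwd ::
  "'a measure \<Rightarrow> (real \<Rightarrow> 'a measure) \<Rightarrow> (real \<Rightarrow> 'a \<Rightarrow> real) \<Rightarrow> real \<Rightarrow> 'a \<Rightarrow> real"
where
  "D_fwd M P X t = (SOME Y. is_fwd_deriv M P X t Y)"

definition D_bwd ::
  "'a measure \<Rightarrow> (real \<Rightarrow> 'a measure) \<Rightarrow> (real \<Rightarrow> 'a \<Rightarrow> real) \<Rightarrow> real \<Rightarrow> 'a \<Rightarrow> real"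
where
  "D_bwd M F X t = (SOME Y. is_bwd_deriv M F X t Y)"

definition nelson_dom ::
  "'a measure \<Rightarrow> (real \<Rightarrow> 'a measure) \<Rightarrow> (real \<Rightarrow> 'a measure) \<Rightarrow> real set \<Rightarrow> (real \<Rightarrow> 'a \<Rightarrow> real) \<Rightarrow> bool"
where
  "nelson_dom M P F I X \<longleftrightarrow>
     bi_adapted M P F I X \<and>
     (\<forall>t\<in>I. (\<exists>Y. is_fwd_deriv M P X t Y) \<and> (\<exists>Y. is_bwd_deriv M F X t Y))"

text \<open>
  Real processes on which \<open>DD\<close>, \<open>DD\<^sub>*\<close>, \<open>D\<^sub>*D\<close> and \<open>D\<^sub>*D\<^sub>*\<close> are all defined.
\<close>

definition nelson_dom2 ::
  "'a measure \<Rightarrow> (real \<Rightarrow> 'a measure) \<Rightarrow> (real \<Rightarrow> 'a measure) \<Rightarrow> real set \<Rightarrow> (real \<Rightarrow> 'a \<Rightarrow> real) \<Rightarrow> bool"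
where
  "nelson_dom2 M P F I X \<longleftrightarrow>
     nelson_dom M P F I X \<and>
     nelson_dom M P F I (D_fwd M P X) \<and>
     nelson_dom M P F I (D_bwd M F X)"

definition re_proc :: "(real \<Rightarrow> 'a \<Rightarrow> complex) \<Rightarrow> real \<Rightarrow> 'a \<Rightarrow> real" where
  "re_proc Z t \<omega> = Re (Z t \<omega>)"

definition im_proc :: "(real \<Rightarrow> 'a \<Rightarrow> complex) \<Rightarrow> real \<Rightarrow> 'a \<Rightarrow> real" where
  "im_proc Z t \<omega> = Im (Z t \<omega>)"

definition clinear_ext ::
  "((real \<Rightarrow> 'a \<Rightarrow> real) \<Rightarrow> real \<Rightarrow> 'a \<Rightarrow> complex) \<Rightarrow> (real \<Rightarrow> 'a \<Rightarrow> complex) \<Rightarrow> real \<Rightarrow> 'a \<Rightarrow> complex"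
where
  "clinear_ext T Z t \<omega> = T (re_proc Z) t \<omega> + \<i> * T (im_proc Z) t \<omega>"

definition D_mix ::
  "'a measure \<Rightarrow> (real \<Rightarrow> 'a measure) \<Rightarrow> (real \<Rightarrow> 'a measure) \<Rightarrow> (real \<Rightarrow> 'a \<Rightarrow> real) \<Rightarrow> real \<Rightarrow> 'a \<Rightarrow> complex"
where
  "D_mix M P F X t \<omega> =
     complex_of_real ((D_fwd M P X t \<omega> + D_bwd M F X t \<omega>) / 2)
     + \<i> * complex_of_real ((D_fwd M P X t \<omega> - D_bwd M F X t \<omega>) / 2)"

abbreviation D_complex ::
  "'a measure \<Rightarrow> (real \<Rightarrow> 'a measure) \<Rightarrow> (real \<Rightarrow> 'a measure) \<Rightarrow> (real \<Rightarrow> 'a \<Rightarrow> complex) \<Rightarrow> real \<Rightarrow> 'a \<Rightarrow> complex"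
where
  "D_complex M P F \<equiv> clinear_ext (D_mix M P F)"

end

theory Submission imports Defs
begin

text \<open>
  The identity is algebra once Nelson's operators are known to be well defined and linear up to
  null sets. The conditional expectation is linear, so the difference quotients and their
  conditioned \<open>L\<^sup>1\<close> limits are linear in the process (\<open>cond_L1_limit_lincomb\<close>). An \<open>L\<^sup>1\<close> limit is
  unique almost surely (\<open>cond_L1_limit_unique\<close>), so the versions chosen by \<open>D\<close> and \<open>D\<^sub>*\<close> do not
  matter: both operators preserve linear combinations almost surely, and their common domain is a
  vector space.

  Now let \<open>Z = A + iB\<close>. Then
  \<open>Re (\<D>\<^sub>\<complex> Z) = (DA + D\<^sub>*A)/2 - (DB - D\<^sub>*B)/2\<close> and
  \<open>Im (\<D>\<^sub>\<complex> Z) = (DA - D\<^sub>*A)/2 + (DB + D\<^sub>*B)/2\<close>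
  are linear combinations of processes in the domain, hence belong to it, and \<open>D\<close> and \<open>D\<^sub>*\<close> can be
  applied to them term by term. What remains is the expansion of
  \<open>((D + D\<^sub>*)/2 + i (D - D\<^sub>*)/2)\<^sup>2\<close> for two operators that need not commute. Its real part is
  \<open>((D + D\<^sub>*)\<^sup>2 - (D - D\<^sub>*)\<^sup>2)/4 = (DD\<^sub>* + D\<^sub>*D)/2\<close>, and its imaginary part is
  \<open>((D + D\<^sub>*)(D - D\<^sub>*) + (D - D\<^sub>*)(D + D\<^sub>*))/4 = (D\<^sup>2 - D\<^sub>*\<^sup>2)/2\<close>.
\<close>

lemma (in prob_space) sigma_finite_subalgebra_of_subalgebra:
  assumes "subalgebra M G"
  shows "sigma_finite_subalgebra M G"
proof -
  interpret finite_measure_subalgebra M G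
    using assms by unfold_locales
  show ?thesis by unfold_locales
qed

text \<open>
  The conditional expectation is almost surely linear on integrable functions, and \<open>Q h\<close>, \<open>R h\<close>
  are integrable for all small \<open>h\<close>. For such \<open>h\<close> the triangle inequality bounds the \<open>L\<^sup>1\<close> error
  of the combination by \<open>\<bar>a\<bar>\<close> and \<open>\<bar>b\<bar>\<close> times the two given errors.
\<close>

lemma (in prob_space) cond_L1_limit_lincomb:
  assumes "subalgebra M G"
    and X: "cond_L1_limit M G Q X" and Y: "cond_L1_limit M G R Y"
  shows "cond_L1_limit M G (\<lambda>h \<omega>. a * Q h \<omega> + b * R h \<omega>) (\<lambda>\<omega>. a * X \<omega> + b * Y \<omega>)"
proof -
  interpret sigma_finite_subalgebra M G
    using assms(1) by (rule sigma_finite_subalgebra_of_subalgebra)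
  let ?E = "real_cond_exp M G"
  let ?S = "\<lambda>h \<omega>. a * Q h \<omega> + b * R h \<omega>"
  let ?e = "\<lambda>h. \<bar>a\<bar> * (\<integral>\<omega>. \<bar>?E (Q h) \<omega> - X \<omega>\<bar> \<partial>M) + \<bar>b\<bar> * (\<integral>\<omega>. \<bar>?E (R h) \<omega> - Y \<omega>\<bar> \<partial>M)"
  have [simp]: "integrable M X" "integrable M Y"
    and limX: "((\<lambda>h. \<integral>\<omega>. \<bar>?E (Q h) \<omega> - X \<omega>\<bar> \<partial>M) \<longlongrightarrow> 0) (at_right 0)"
    and limY: "((\<lambda>h. \<integral>\<omega>. \<bar>?E (R h) \<omega> - Y \<omega>\<bar> \<partial>M) \<longlongrightarrow> 0) (at_right 0)"
    using X Y by (simp_all add: cond_L1_limit_def)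
  have int: "\<forall>\<^sub>F h in at_right 0. integrable M (Q h) \<and> integrable M (R h)"
    using X Y by (simp add: cond_L1_limit_def eventually_conj_iff)
  have bound: "(\<integral>\<omega>. \<bar>?E (?S h) \<omega> - (a * X \<omega> + b * Y \<omega>)\<bar> \<partial>M) \<le> ?e h"
    if "integrable M (Q h) \<and> integrable M (R h)" for h
  proof -
    have [simp]: "integrable M (Q h)" "integrable M (R h)" using that by auto
    have [simp]: "integrable M (?E (Q h))" "integrable M (?E (R h))" "integrable M (?E (?S h))"
      by (simp_all add: real_cond_exp_int(1))
    have "AE \<omega> in M. ?E (?S h) \<omega> = a * ?E (Q h) \<omega> + b * ?E (R h) \<omega>"
    proof -
      have "AE \<omega> in M. ?E (?S h) \<omega> = ?E (\<lambda>\<omega>. a * Q h \<omega>) \<omega> + ?E (\<lambda>\<omega>. b * R h \<omega>) \<omega>"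
        by (rule real_cond_exp_add) simp_all
      moreover have "AE \<omega> in M. ?E (\<lambda>\<omega>. a * Q h \<omega>) \<omega> = a * ?E (Q h) \<omega>"
        by (rule real_cond_exp_cmult) simp
      moreover have "AE \<omega> in M. ?E (\<lambda>\<omega>. b * R h \<omega>) \<omega> = b * ?E (R h) \<omega>"
        by (rule real_cond_exp_cmult) simp
      ultimately show ?thesis
        by eventually_elim simp
    qed
    then have "AE \<omega> in M. \<bar>?E (?S h) \<omega> - (a * X \<omega> + b * Y \<omega>)\<bar>
        \<le> \<bar>a\<bar> * \<bar>?E (Q h) \<omega> - X \<omega>\<bar> + \<bar>b\<bar> * \<bar>?E (R h) \<omega> - Y \<omega>\<bar>"
    proof eventually_elim
      case (elim \<omega>)
      have "?E (?S h) \<omega> - (a * X \<omega> + b * Y \<omega>) = a * (?E (Q h) \<omega> - X \<omega>) + b * (?E (R h) \<omega> - Y \<omega>)"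
        by (simp add: elim algebra_simps)
      then show ?case
        by (metis abs_mult abs_triangle_ineq)
    qed
    then have "(\<integral>\<omega>. \<bar>?E (?S h) \<omega> - (a * X \<omega> + b * Y \<omega>)\<bar> \<partial>M)
        \<le> (\<integral>\<omega>. \<bar>a\<bar> * \<bar>?E (Q h) \<omega> - X \<omega>\<bar> + \<bar>b\<bar> * \<bar>?E (R h) \<omega> - Y \<omega>\<bar> \<partial>M)"
      by (intro integral_mono_AE) simp_all
    then show ?thesis by simp
  qed
  have "((\<lambda>h. \<integral>\<omega>. \<bar>?E (?S h) \<omega> - (a * X \<omega> + b * Y \<omega>)\<bar> \<partial>M) \<longlongrightarrow> 0) (at_right 0)"
  proof (rule tendsto_sandwich)
    show "\<forall>\<^sub>F h in at_right 0. 0 \<le> (\<integral>\<omega>. \<bar>?E (?S h) \<omega> - (a * X \<omega> + b * Y \<omega>)\<bar> \<partial>M)"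
      by simp
    show "\<forall>\<^sub>F h in at_right 0. (\<integral>\<omega>. \<bar>?E (?S h) \<omega> - (a * X \<omega> + b * Y \<omega>)\<bar> \<partial>M) \<le> ?e h"
      using int by eventually_elim (rule bound)
    show "(?e \<longlongrightarrow> 0) (at_right 0)"
      using tendsto_add[OF tendsto_mult_right_zero[OF limX, of "\<bar>a\<bar>"]
          tendsto_mult_right_zero[OF limY, of "\<bar>b\<bar>"]]
      by simp
  qed simp
  moreover have "\<forall>\<^sub>F h in at_right 0. integrable M (?S h)"
    using int by eventually_elim simp
  ultimately show ?thesis by (simp add: cond_L1_limit_def)
qed

text \<open>
  Both candidates are arbitrarily close in \<open>L\<^sup>1\<close> to the same conditional expectation, so their
  \<open>L\<^sup>1\<close> distance is zero.
\<close>

lemma (in prob_space) cond_L1_limit_unique: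
  assumes "subalgebra M G"
    and X: "cond_L1_limit M G Q X" and Y: "cond_L1_limit M G Q Y"
  shows "AE \<omega> in M. X \<omega> = Y \<omega>"
proof -
  interpret sigma_finite_subalgebra M G
    using assms(1) by (rule sigma_finite_subalgebra_of_subalgebra)
  let ?e = "\<lambda>h X. \<integral>\<omega>. \<bar>real_cond_exp M G (Q h) \<omega> - X \<omega>\<bar> \<partial>M"
  have [simp]: "integrable M X" "integrable M Y"
    using X Y by (simp_all add: cond_L1_limit_def)
  have "((\<lambda>h. ?e h X + ?e h Y) \<longlongrightarrow> 0 + 0) (at_right 0)"
    using X Y by (intro tendsto_add) (simp_all add: cond_L1_limit_def)
  moreover have "\<forall>\<^sub>F h in at_right 0. (\<integral>\<omega>. \<bar>X \<omega> - Y \<omega>\<bar> \<partial>M) \<le> ?e h X + ?e h Y"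
  proof -
    have "\<forall>\<^sub>F h in at_right 0. integrable M (Q h)"
      using X by (simp add: cond_L1_limit_def)
    then show ?thesis
    proof eventually_elim
      case (elim h)
      then have [simp]: "integrable M (real_cond_exp M G (Q h))"
        by (rule real_cond_exp_int(1))
      have "(\<integral>\<omega>. \<bar>X \<omega> - Y \<omega>\<bar> \<partial>M)
          \<le> (\<integral>\<omega>. \<bar>real_cond_exp M G (Q h) \<omega> - X \<omega>\<bar> + \<bar>real_cond_exp M G (Q h) \<omega> - Y \<omega>\<bar> \<partial>M)"
        by (intro integral_mono) simp_all
      then show ?case by simp
    qed
  qed
  ultimately have "(\<integral>\<omega>. \<bar>X \<omega> - Y \<omega>\<bar> \<partial>M) \<le> 0"
    by (intro tendsto_lowerbound[where F = "at_right (0::real)"]) auto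
  then have "(\<integral>\<omega>. \<bar>X \<omega> - Y \<omega>\<bar> \<partial>M) = 0"
    by (simp add: order.antisym)
  then show ?thesis
    by (subst (asm) integral_nonneg_eq_0_iff_AE) simp_all
qed

lemma (in prob_space) is_fwd_deriv_lincomb:
  assumes "subalgebra M (P t)" "is_fwd_deriv M P X t X'" "is_fwd_deriv M P Y t Y'"
  shows "is_fwd_deriv M P (\<lambda>t \<omega>. a * X t \<omega> + b * Y t \<omega>) t (\<lambda>\<omega>. a * X' \<omega> + b * Y' \<omega>)"
  using cond_L1_limit_lincomb[OF assms[unfolded is_fwd_deriv_def], of a b]
  by (simp add: is_fwd_deriv_def add_divide_distrib diff_divide_distrib algebra_simps)

lemma (in prob_space) is_bwd_deriv_lincomb:
  assumes "subalgebra M (F t)" "is_bwd_deriv M F X t X'" "is_bwd_deriv M F Y t Y'"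
  shows "is_bwd_deriv M F (\<lambda>t \<omega>. a * X t \<omega> + b * Y t \<omega>) t (\<lambda>\<omega>. a * X' \<omega> + b * Y' \<omega>)"
  using cond_L1_limit_lincomb[OF assms[unfolded is_bwd_deriv_def], of a b]
  by (simp add: is_bwd_deriv_def add_divide_distrib diff_divide_distrib algebra_simps)

lemma is_fwd_deriv_D_fwd:
  assumes "nelson_dom M P F I X" "t \<in> I"
  shows "is_fwd_deriv M P X t (D_fwd M P X t)"
  using assms unfolding nelson_dom_def D_fwd_def by (metis someI_ex)

lemma is_bwd_deriv_D_bwd:
  assumes "nelson_dom M P F I X" "t \<in> I"
  shows "is_bwd_deriv M F X t (D_bwd M F X t)"
  using assms unfolding nelson_dom_def D_bwd_def by (metis someI_ex)

lemma as_measurable_lincomb: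
  assumes "as_measurable M G f" "as_measurable M G g"
  shows "as_measurable M G (\<lambda>\<omega>. a * f \<omega> + b * g \<omega>)"
proof -
  obtain f' g' where [measurable]: "f' \<in> borel_measurable G" "g' \<in> borel_measurable G"
    and "AE \<omega> in M. f \<omega> = f' \<omega>" "AE \<omega> in M. g \<omega> = g' \<omega>"
    using assms by (auto simp: as_measurable_def)
  then have "AE \<omega> in M. a * f \<omega> + b * g \<omega> = a * f' \<omega> + b * g' \<omega>" by auto
  then show ?thesis
    unfolding as_measurable_def by (intro bexI[of _ "\<lambda>\<omega>. a * f' \<omega> + b * g' \<omega>"]) simp_all
qed

locale nelson_filtrations = prob_space M for M :: "'a measure" +
  fixes P F :: "real \<Rightarrow> 'a measure" and I :: "real set"
  assumes subalgebra_past: "t \<in> I \<Longrightarrow> subalgebra M (P t)"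
    and subalgebra_future: "t \<in> I \<Longrightarrow> subalgebra M (F t)"
begin

lemma nelson_dom_lincomb:
  assumes X: "nelson_dom M P F I X" and Y: "nelson_dom M P F I Y"
  shows "nelson_dom M P F I (\<lambda>t \<omega>. a * X t \<omega> + b * Y t \<omega>)"
proof -
  have "bi_adapted M P F I (\<lambda>t \<omega>. a * X t \<omega> + b * Y t \<omega>)"
    using X Y by (auto simp: nelson_dom_def bi_adapted_def intro!: as_measurable_lincomb borel_measurable_add
        borel_measurable_times)
  then show ?thesis
    unfolding nelson_dom_def
    using is_fwd_deriv_lincomb[OF subalgebra_past is_fwd_deriv_D_fwd[OF X] is_fwd_deriv_D_fwd[OF Y]]
      is_bwd_deriv_lincomb[OF subalgebra_future is_bwd_deriv_D_bwd[OF X] is_bwd_deriv_D_bwd[OF Y]]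
    by blast
qed

text \<open>
  The version chosen by \<open>D\<close> for the combination and the combination of the chosen versions are both
  limits of the same quotients, hence agree almost surely.
\<close>

lemma D_fwd_lincomb:
  assumes X: "nelson_dom M P F I X" and Y: "nelson_dom M P F I Y" and t: "t \<in> I"
  shows "AE \<omega> in M. D_fwd M P (\<lambda>t \<omega>. a * X t \<omega> + b * Y t \<omega>) t \<omega>
    = a * D_fwd M P X t \<omega> + b * D_fwd M P Y t \<omega>"
  using cond_L1_limit_unique[OF subalgebra_past[OF t],
      OF is_fwd_deriv_D_fwd[OF nelson_dom_lincomb[OF X Y] t, unfolded is_fwd_deriv_def]
        is_fwd_deriv_lincomb[where a = a and b = b, OF subalgebra_past is_fwd_deriv_D_fwd[OF X]
          is_fwd_deriv_D_fwd[OF Y], OF t t t, unfolded is_fwd_deriv_def]] .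

lemma D_bwd_lincomb:
  assumes X: "nelson_dom M P F I X" and Y: "nelson_dom M P F I Y" and t: "t \<in> I"
  shows "AE \<omega> in M. D_bwd M F (\<lambda>t \<omega>. a * X t \<omega> + b * Y t \<omega>) t \<omega>
    = a * D_bwd M F X t \<omega> + b * D_bwd M F Y t \<omega>"
  using cond_L1_limit_unique[OF subalgebra_future[OF t],
      OF is_bwd_deriv_D_bwd[OF nelson_dom_lincomb[OF X Y] t, unfolded is_bwd_deriv_def]
        is_bwd_deriv_lincomb[where a = a and b = b, OF subalgebra_future is_bwd_deriv_D_bwd[OF X]
          is_bwd_deriv_D_bwd[OF Y], OF t t t, unfolded is_bwd_deriv_def]] .

text \<open>
  The real and the imaginary part of \<open>\<D>\<^sub>\<complex> Z\<close> are both combinations of four processes with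
  coefficients \<open>\<plusminus>1/2\<close>.
\<close>

lemma
  fixes a b c d :: real
  defines "L \<equiv> \<lambda>V W X Y (t::real) (\<omega>::'a). a * V t \<omega> + b * W t \<omega> + (c * X t \<omega> + d * Y t \<omega>)"
  assumes V: "nelson_dom M P F I V" and W: "nelson_dom M P F I W"
    and X: "nelson_dom M P F I X" and Y: "nelson_dom M P F I Y"
  shows nelson_dom_lincomb4: "nelson_dom M P F I (L V W X Y)"
    and D_fwd_lincomb4: "t \<in> I \<Longrightarrow> AE \<omega> in M. D_fwd M P (L V W X Y) t \<omega>
      = L (D_fwd M P V) (D_fwd M P W) (D_fwd M P X) (D_fwd M P Y) t \<omega>"
    and D_bwd_lincomb4: "t \<in> I \<Longrightarrow> AE \<omega> in M. D_bwd M F (L V W X Y) t \<omega>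
      = L (D_bwd M F V) (D_bwd M F W) (D_bwd M F X) (D_bwd M F Y) t \<omega>"
proof -
  note VW = nelson_dom_lincomb[OF V W, of a b] and XY = nelson_dom_lincomb[OF X Y, of c d]
  show "nelson_dom M P F I (L V W X Y)"
    using nelson_dom_lincomb[OF VW XY, of 1 1] by (simp add: L_def)
  show "AE \<omega> in M. D_fwd M P (L V W X Y) t \<omega>
      = L (D_fwd M P V) (D_fwd M P W) (D_fwd M P X) (D_fwd M P Y) t \<omega>" if t: "t \<in> I"
    using D_fwd_lincomb[OF VW XY t, of 1 1] D_fwd_lincomb[OF V W t, of a b]
      D_fwd_lincomb[OF X Y t, of c d]
    by eventually_elim (simp add: L_def)
  show "AE \<omega> in M. D_bwd M F (L V W X Y) t \<omega>
      = L (D_bwd M F V) (D_bwd M F W) (D_bwd M F X) (D_bwd M F Y) t \<omega>" if t: "t \<in> I"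
    using D_bwd_lincomb[OF VW XY t, of 1 1] D_bwd_lincomb[OF V W t, of a b]
      D_bwd_lincomb[OF X Y t, of c d]
    by eventually_elim (simp add: L_def)
qed

end


theorem lemma2p3:
  fixes M :: "'a measure"
    and P F :: "real \<Rightarrow> 'a measure"
    and I :: "real set"
    and Z :: "real \<Rightarrow> 'a \<Rightarrow> complex"
  assumes "prob_space M"
    and "open I" and "is_interval I"
    and "\<And>t. t \<in> I \<Longrightarrow> subalgebra M (P t)"
    and "\<And>t. t \<in> I \<Longrightarrow> subalgebra M (F t)"
    and "\<And>s t. s \<in> I \<Longrightarrow> t \<in> I \<Longrightarrow> s \<le> t \<Longrightarrow> sets (P s) \<subseteq> sets (P t)"
    and "\<And>s t. s \<in> I \<Longrightarrow> t \<in> I \<Longrightarrow> s \<le> t \<Longrightarrow> sets (F t) \<subseteq> sets (F s)"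
    and "nelson_dom2 M P F I (re_proc Z)"
    and "nelson_dom2 M P F I (im_proc Z)"
  shows "nelson_dom M P F I (re_proc (D_complex M P F Z)) \<and>
         nelson_dom M P F I (im_proc (D_complex M P F Z)) \<and>
         (\<forall>t\<in>I. AE \<omega> in M.
            (D_complex M P F \<circ> D_complex M P F) Z t \<omega> =
            clinear_ext (\<lambda>X t \<omega>.
                complex_of_real
                  ((D_fwd M P (D_bwd M F X) t \<omega> + D_bwd M F (D_fwd M P X) t \<omega>) / 2)
                + \<i> * complex_of_real
                  ((D_fwd M P (D_fwd M P X) t \<omega> - D_bwd M F (D_bwd M F X) t \<omega>) / 2)) Z t \<omega>)"
proof -
  interpret nelson_filtrations M P F I
    using assms(1,4,5) by (simp add: nelson_filtrations_def nelson_filtrations_axioms_def)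
  let ?D = "D_fwd M P" and ?B = "D_bwd M F"
  let ?X = "re_proc Z" and ?Y = "im_proc Z"
  let ?W = "D_complex M P F Z"
  have dom: "nelson_dom M P F I (?D ?X)" "nelson_dom M P F I (?B ?X)"
    "nelson_dom M P F I (?D ?Y)" "nelson_dom M P F I (?B ?Y)"
    using assms(8,9) by (simp_all add: nelson_dom2_def)
  have re: "re_proc ?W = (\<lambda>t \<omega>. 1/2 * ?D ?X t \<omega> + 1/2 * ?B ?X t \<omega>
      + (- (1/2) * ?D ?Y t \<omega> + 1/2 * ?B ?Y t \<omega>))"
    by (simp add: fun_eq_iff re_proc_def[of ?W] clinear_ext_def D_mix_def field_simps)
  have im: "im_proc ?W = (\<lambda>t \<omega>. 1/2 * ?D ?X t \<omega> + - (1/2) * ?B ?X t \<omega>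
      + (1/2 * ?D ?Y t \<omega> + 1/2 * ?B ?Y t \<omega>))"
    by (simp add: fun_eq_iff im_proc_def[of ?W] clinear_ext_def D_mix_def field_simps)
  have "AE \<omega> in M. (D_complex M P F \<circ> D_complex M P F) Z t \<omega> =
      clinear_ext (\<lambda>X t \<omega>.
          complex_of_real ((?D (?B X) t \<omega> + ?B (?D X) t \<omega>) / 2)
          + \<i> * complex_of_real ((?D (?D X) t \<omega> - ?B (?B X) t \<omega>) / 2)) Z t \<omega>"
    if t: "t \<in> I" for t
    using D_fwd_lincomb4[OF dom t, of "1/2" "1/2" "- (1/2)" "1/2", folded re]
      D_bwd_lincomb4[OF dom t, of "1/2" "1/2" "- (1/2)" "1/2", folded re]
      D_fwd_lincomb4[OF dom t, of "1/2" "- (1/2)" "1/2" "1/2", folded im]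
      D_bwd_lincomb4[OF dom t, of "1/2" "- (1/2)" "1/2" "1/2", folded im]
  proof eventually_elim
    case (elim \<omega>)
    have "(D_complex M P F \<circ> D_complex M P F) Z t \<omega>
        = D_mix M P F (re_proc ?W) t \<omega> + \<i> * D_mix M P F (im_proc ?W) t \<omega>"
      by (simp add: clinear_ext_def[of _ ?W])
    then show ?case
      unfolding D_mix_def elim clinear_ext_def[of _ Z]
      by (simp add: complex_eq_iff field_simps)
  qed
  then show ?thesis
    using nelson_dom_lincomb4[OF dom, of "1/2" "1/2" "- (1/2)" "1/2", folded re]
      nelson_dom_lincomb4[OF dom, of "1/2" "- (1/2)" "1/2" "1/2", folded im]
    by blast
qed

end
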